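(* Let $\mathbb{A}$ be a finite set and let $\{X_t\}$ be a stationary Markov chain assuming values in $\mathbb{A}$, with doublet frequency distribution $\boldsymbol{\mu}\in\mathcal{M}_s(\mathbb{A}^2)$, $\mu_{ij}=\Pr\{X_t=i,\,X_{t+1}=j\}$. Suppose $\mu_{ij}>0$ for all $i,j\in\mathbb{A}$. For a sample path $x_1^l=x_1\cdots x_l$ define the empirical doublet distribution $$\nu_{ij}(x_1^l):=\frac1l\sum_{t=1}^{l} I_{\{x_tx_{t+1}=ij\}},\qquad i,j\in\mathbb{A},$$ where $x_{l+1}$ is taken as $x_1$. Then the $\mathcal{M}_s(\mathbb{A}^2)$-valued process $\{\boldsymbol{\nu}(x_1^l)\}_{l\ge 1}$ satisfies the large deviation property with rate function $$I(\boldsymbol{\nu}):=D_c(\boldsymbol{\nu}\,\Vert\,\boldsymbol{\mu}),\qquad \boldsymbol{\nu}\in\mathcal{M}_s(\mathbb{A}^2).$$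
   Context: $\mathbb{A}=\{1,\dots,n\}$ is a finite set of $n$ symbols, and $I_{\{\cdot\}}$ denotes an indicator function. A probability distribution $\boldsymbol{\nu}$ on $\mathbb{A}^2$ is stationary if $\sum_{j\in\mathbb{A}}\nu_{ij}=\sum_{j\in\mathbb{A}}\nu_{ji}$ for all $i\in\mathbb{A}$; $\mathcal{M}_s(\mathbb{A}^2)$ is the set of stationary distributions on $\mathbb{A}^2$, viewed as a subset of $\mathbb{R}^{n^2}$ with the $\ell_1$-norm (total variation) topology. For every sample path, $\boldsymbol{\nu}(x_1^l)\in\mathcal{M}_s(\mathbb{A}^2)$. For $\boldsymbol{\nu}\in\mathcal{M}_s(\mathbb{A}^2)$, its one-dimensional marginal $\bar{\boldsymbol{\nu}}$ is $\bar\nu_i=\sum_{j}\nu_{ij}$. Relative entropy: $D(\boldsymbol{\nu}\Vert\boldsymbol{\mu})=\sum_i\nu_i\log(\nu_i/\mu_i)$ (sum over the underlying finite set, natural logarithm, $0\log 0=0$). Conditional relative entropy: for $\boldsymbol{\nu},\boldsymbol{\mu}\in\mathcal{M}_s(\mathbb{A}^2)$, $D_c(\boldsymbol{\nu}\Vert\boldsymbol{\mu}):=D(\boldsymbol{\nu}\Vert\boldsymbol{\mu})-D(\bar{\boldsymbol{\nu}}\Vert\bar{\boldsymbol{\mu}})$. Large deviation property (LDP): let $\tilde P_\mu$ be the law of the process $\{X_t\}$ and let $\hat{\boldsymbol{\mu}}(x_1^l)$, $l\ge1$, be empirical distributions (functions of the first $l$ samples) taking values in a set $S$ of probability distributions,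 with the topology above. The process $\{\hat{\boldsymbol{\mu}}(x_1^l)\}$ satisfies the LDP with rate function $I:S\to\mathbb{R}\cup\{\infty\}$ if (1) for each open $\Gamma\subseteq S$, $-\inf_{\boldsymbol{\nu}\in\Gamma}I(\boldsymbol{\nu})\le\liminf_{l\to\infty}\frac1l\log\tilde P_\mu\{\hat{\boldsymbol{\mu}}(x_1^l)\in\Gamma\}$; and (2) for each closed $\Gamma\subseteq S$, $\limsup_{l\to\infty}\frac1l\log\tilde P_\mu\{\hat{\boldsymbol{\mu}}(x_1^l)\in\Gamma\}\le-\inf_{\boldsymbol{\nu}\in\Gamma}I(\boldsymbol{\nu})$. Conventions: $\log 0=-\infty$, $\inf\emptyset=+\infty$. Here $S=\mathcal{M}_s(\mathbb{A}^2)$. *)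

theory Defs
  imports "HOL-Probability.Probability"
begin

section \<open>Distributions on finite alphabets\<close>

text \<open>Distributions on a finite type are vectors of probabilities, so the alphabet is a type
  \<^typ>\<open>'a::finite\<close> and doublets are indexed by \<^typ>\<open>'a \<times> 'a\<close>.\<close>

definition distributions :: "(real ^ 'n::finite) set" where
  "distributions = {\<nu>. (\<forall>i. 0 \<le> \<nu> $ i) \<and> (\<Sum>i\<in>UNIV. \<nu> $ i) = 1}"

definition stationary_distributions :: "(real ^ ('a::finite \<times> 'a)) set" where
  "stationary_distributions =
    {\<nu> \<in> distributions. \<forall>i. (\<Sum>j\<in>UNIV. \<nu> $ (i, j)) = (\<Sum>j\<in>UNIV. \<nu> $ (j, i))}"

text \<open>The type \<^typ>\<open>real ^ 'n\<close> carries the Euclidean topology; the following lemma shows that the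
  relatively open sets are exactly those of the \<open>\<ell>\<^sub>1\<close>-norm.\<close>

lemma openin_top_of_set_iff_l1:
  fixes S :: "(real ^ 'n::finite) set"
  shows "openin (top_of_set S) \<Gamma> \<longleftrightarrow>
    \<Gamma> \<subseteq> S \<and> (\<forall>\<nu>\<in>\<Gamma>. \<exists>e>0. \<forall>\<xi>\<in>S. (\<Sum>i\<in>UNIV. \<bar>\<xi> $ i - \<nu> $ i\<bar>) < e \<longrightarrow> \<xi> \<in> \<Gamma>)"
    (is "_ \<longleftrightarrow> _ \<and> ?l1")
proof -
  have upper: "dist \<xi> \<nu> \<le> (\<Sum>i\<in>UNIV. \<bar>\<xi> $ i - \<nu> $ i\<bar>)" for \<xi> \<nu> :: "real ^ 'n"
    using norm_le_l1_cart[of "\<xi> - \<nu>"] by (simp add: dist_norm)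
  have lower: "(\<Sum>i\<in>UNIV. \<bar>\<xi> $ i - \<nu> $ i\<bar>) \<le> real CARD('n) * dist \<xi> \<nu>" for \<xi> \<nu> :: "real ^ 'n"
  proof -
    have "(\<Sum>i\<in>UNIV. \<bar>\<xi> $ i - \<nu> $ i\<bar>) \<le> (\<Sum>i\<in>(UNIV::'n set). dist \<xi> \<nu>)"
      by (intro sum_mono) (metis component_le_norm_cart dist_norm vector_minus_component)
    then show ?thesis by simp
  qed
  have card: "real CARD('n) > 0" by simp
  have "(\<exists>e>0. \<forall>\<xi>\<in>S. dist \<xi> \<nu> < e \<longrightarrow> \<xi> \<in> \<Gamma>) \<longleftrightarrow>
      (\<exists>e>0. \<forall>\<xi>\<in>S. (\<Sum>i\<in>UNIV. \<bar>\<xi> $ i - \<nu> $ i\<bar>) < e \<longrightarrow> \<xi> \<in> \<Gamma>)" (is "?A \<longleftrightarrow> ?B") for \<nu>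
  proof
    assume ?A then show ?B using upper by (meson le_less_trans)
  next
    assume ?B
    then obtain e where e: "e > 0"
      "\<forall>\<xi>\<in>S. (\<Sum>i\<in>UNIV. \<bar>\<xi> $ i - \<nu> $ i\<bar>) < e \<longrightarrow> \<xi> \<in> \<Gamma>" by blast
    show ?A
    proof (intro exI conjI ballI impI)
      show "e / real CARD('n) > 0" using e(1) card by simp
      fix \<xi> assume \<xi>: "\<xi> \<in> S" "dist \<xi> \<nu> < e / real CARD('n)"
      have "(\<Sum>i\<in>UNIV. \<bar>\<xi> $ i - \<nu> $ i\<bar>) \<le> real CARD('n) * dist \<xi> \<nu>" by (rule lower)
      also have "\<dots> < e" using \<xi>(2) card by (simp add: field_simps)
      finally show "\<xi> \<in> \<Gamma>" using e(2) \<xi>(1) by blast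
    qed
  qed
  then show ?thesis by (auto simp: openin_euclidean_subtopology_iff)
qed

definition marginal :: "real ^ ('a::finite \<times> 'a) \<Rightarrow> real ^ 'a" where
  "marginal \<nu> = (\<chi> i. \<Sum>j\<in>UNIV. \<nu> $ (i, j))"

text \<open>Natural logarithm, with \<open>0 log 0 = 0\<close> and value \<open>\<infinity>\<close> outside absolute continuity.\<close>

definition rel_entropy :: "real ^ 'n::finite \<Rightarrow> real ^ 'n \<Rightarrow> ereal" where
  "rel_entropy \<nu> \<mu> = (\<Sum>i\<in>UNIV.
     if \<nu> $ i = 0 then 0
     else if \<mu> $ i = 0 then \<infinity>
     else ereal (\<nu> $ i * ln (\<nu> $ i / \<mu> $ i)))"

definition cond_rel_entropy ::
    "real ^ ('a::finite \<times> 'a) \<Rightarrow> real ^ ('a \<times> 'a) \<Rightarrow> ereal" where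
  "cond_rel_entropy \<nu> \<mu> = rel_entropy \<nu> \<mu> - rel_entropy (marginal \<nu>) (marginal \<mu>)"


section \<open>Stationary Markov chains\<close>

text \<open>The time axis is \<open>t \<ge> 1\<close>; nothing is required of \<open>X 0\<close>.\<close>

definition markov_chain :: "'w measure \<Rightarrow> (nat \<Rightarrow> 'w \<Rightarrow> 'a::finite) \<Rightarrow> bool" where
  "markov_chain M X \<longleftrightarrow>
    (\<forall>t\<ge>1. X t \<in> measurable M (count_space UNIV)) \<and>
    (\<forall>t\<ge>1. \<forall>x j. \<P>(\<omega> in M. \<forall>s\<in>{1..t}. X s \<omega> = x s) > 0 \<longrightarrow>
       \<P>(\<omega> in M. X (t + 1) \<omega> = j \<bar> \<forall>s\<in>{1..t}. X s \<omega> = x s) =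
       \<P>(\<omega> in M. X (t + 1) \<omega> = j \<bar> X t \<omega> = x t))"

definition stationary_process :: "'w measure \<Rightarrow> (nat \<Rightarrow> 'w \<Rightarrow> 'a::finite) \<Rightarrow> bool" where
  "stationary_process M X \<longleftrightarrow>
    (\<forall>k l x. \<P>(\<omega> in M. \<forall>t\<in>{1..l}. X (t + k) \<omega> = x t) =
             \<P>(\<omega> in M. \<forall>t\<in>{1..l}. X t \<omega> = x t))"

text \<open>Depends only on \<open>x 1, \<dots>, x l\<close>: the last doublet wraps around to \<open>x 1\<close>.\<close>

definition empirical_doublet :: "nat \<Rightarrow> (nat \<Rightarrow> 'a::finite) \<Rightarrow> real ^ ('a \<times> 'a)" where
  "empirical_doublet l x =
    (\<chi> ij. 1 / real l *
      (\<Sum>t=1..l. indicator {ij} (x t, if t = l then x 1 else x (t + 1))))"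


section \<open>Large deviation property\<close>

definition elog :: "real \<Rightarrow> ereal" where
  "elog p = (if p = 0 then - \<infinity> else ereal (ln p))"

text \<open>\<open>Z l\<close> is required to take values in the space of \<open>T\<close> for \<open>l \<ge> 1\<close>, and the rate
  function has values in \<open>\<real> \<union> {\<infinity>}\<close> there.
  In \<^typ>\<open>ereal\<close> the infimum over the empty set is \<open>\<infinity>\<close>.\<close>

definition large_deviation_property ::
    "'w measure \<Rightarrow> 'b topology \<Rightarrow> (nat \<Rightarrow> 'w \<Rightarrow> 'b) \<Rightarrow> ('b \<Rightarrow> ereal) \<Rightarrow> bool" where
  "large_deviation_property M T Z I \<longleftrightarrow>
    (\<forall>l\<ge>1. \<forall>\<omega>\<in>space M. Z l \<omega> \<in> topspace T) \<and>
    (\<forall>\<nu>\<in>topspace T. I \<nu> \<noteq> - \<infinity>) \<and>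
    (\<forall>\<Gamma>. openin T \<Gamma> \<longrightarrow>
       - (INF \<nu>\<in>\<Gamma>. I \<nu>) \<le> liminf (\<lambda>l. ereal (1 / real l) * elog \<P>(\<omega> in M. Z l \<omega> \<in> \<Gamma>))) \<and>
    (\<forall>\<Gamma>. closedin T \<Gamma> \<longrightarrow>
       limsup (\<lambda>l. ereal (1 / real l) * elog \<P>(\<omega> in M. Z l \<omega> \<in> \<Gamma>)) \<le> - (INF \<nu>\<in>\<Gamma>. I \<nu>))"

end

theory Submission
  imports Defs
begin

text \<open>Write \<open>P\<close> for the transition matrix of \<open>\<mu>\<close>. Up to a bounded factor (the wrap-around step), a word
  of length \<open>l\<close> with empirical doublet distribution \<open>\<xi>\<close> has probability \<open>exp (l \<Sum> \<xi>\<^sub>i\<^sub>j ln P\<^sub>i\<^sub>j)\<close>, and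
  the product of the transition probabilities \<open>\<xi>\<^sub>i\<^sub>j / \<xi>\<^sub>i\<close> along it is at least
  \<open>exp (l \<Sum> \<xi>\<^sub>i\<^sub>j ln (\<xi>\<^sub>i\<^sub>j / \<xi>\<^sub>i))\<close>. Over all words these products add up to the size of the alphabet,
  which bounds the number of words with the given \<open>\<xi>\<close>; there are only polynomially many \<open>\<xi>\<close>, and the upper bound follows for arbitrary sets.

  The lower bound is a change of measure to the chain of a positive \<open>\<nu>\<close> in the open set. The law of
  large numbers that it needs is a consequence of the upper bound, applied to the chain of \<open>\<nu>\<close>: on the
  compact complement of a neighbourhood of \<open>\<nu>\<close> the continuous rate function \<open>D\<^sub>c(\<cdot> \<parallel> \<nu>)\<close> is bounded away
  from 0, because it vanishes only at \<open>\<nu>\<close>. Points \<open>\<nu>\<close> with zero entries are approximated by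
  convex combinations with \<open>\<mu>\<close>.\<close>

section \<open>Transition matrices and conditional divergence\<close>

text \<open>The uniform row for states of mass 0 makes \<^term>\<open>kern \<nu>\<close> a stochastic matrix in all cases.\<close>

definition kern :: "real ^ ('a::finite \<times> 'a) \<Rightarrow> 'a \<Rightarrow> 'a \<Rightarrow> real" where
  "kern \<nu> i j = (if marginal \<nu> $ i = 0 then 1 / real CARD('a) else \<nu> $ (i, j) / marginal \<nu> $ i)"

text \<open>The chain-rule form of the conditional relative entropy: divergences between rows of the
  two transition matrices, averaged over the initial state. It is real valued, and where
  \<open>\<nu> $ (i, j) = 0\<close> the factor removes the summand whatever the logarithm
  returns.\<close>

definition cond_div :: "real ^ ('a::finite \<times> 'a) \<Rightarrow> real ^ ('a \<times> 'a) \<Rightarrow> real" where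
  "cond_div \<nu> \<mu> = (\<Sum>(i, j)\<in>UNIV. \<nu> $ (i, j) * ln (kern \<nu> i j / kern \<mu> i j))"

lemma marginal_nth: "marginal \<nu> $ i = (\<Sum>j\<in>UNIV. \<nu> $ (i, j))"
  by (simp add: marginal_def)

lemma sum_UNIV_prod: "(\<Sum>ij\<in>(UNIV::('a::finite \<times> 'b::finite) set). f ij) = (\<Sum>i\<in>UNIV. \<Sum>j\<in>UNIV. f (i, j))"
  by (simp add: sum.cartesian_product UNIV_Times_UNIV[symmetric] del: UNIV_Times_UNIV)

lemma distributions_nonneg: "\<nu> \<in> distributions \<Longrightarrow> 0 \<le> \<nu> $ i"
  by (simp add: distributions_def)

lemma stationary_distributionsD:
  assumes "\<nu> \<in> stationary_distributions"
  shows "\<nu> \<in> distributions" "\<And>i. 0 \<le> \<nu> $ i" "(\<Sum>ij\<in>UNIV. \<nu> $ ij) = 1"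
    "\<And>i. (\<Sum>j\<in>UNIV. \<nu> $ (j, i)) = marginal \<nu> $ i"
    "(\<Sum>i\<in>UNIV. marginal \<nu> $ i) = 1"
  using assms
  by (auto simp: stationary_distributions_def distributions_def marginal_nth
      sum_UNIV_prod[of "($) \<nu>"])

lemma nth_le_marginal:
  assumes "\<nu> \<in> distributions"
  shows "\<nu> $ (i, j) \<le> marginal \<nu> $ i"
  unfolding marginal_nth
  by (rule member_le_sum) (use assms in \<open>auto simp: distributions_nonneg\<close>)

lemma marginal_nonneg: "\<nu> \<in> distributions \<Longrightarrow> 0 \<le> marginal \<nu> $ i"
  by (simp add: marginal_nth sum_nonneg distributions_nonneg)

lemma marginal_pos: "(\<And>i j. 0 < \<nu> $ (i, j)) \<Longrightarrow> 0 < marginal \<nu> $ i"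
  by (simp add: marginal_nth sum_pos)

lemma kern_nonneg: "\<nu> \<in> distributions \<Longrightarrow> 0 \<le> kern \<nu> i j"
  by (simp add: kern_def distributions_nonneg marginal_nonneg)

lemma kern_le_1: "\<nu> \<in> distributions \<Longrightarrow> kern \<nu> i j \<le> 1"
  using nth_le_marginal[of \<nu> i j] marginal_nonneg[of \<nu> i]
  by (auto simp: kern_def divide_simps)

lemma kern_pos_of_nth: "\<nu> \<in> distributions \<Longrightarrow> \<nu> $ (i, j) > 0 \<Longrightarrow> kern \<nu> i j > 0"
  using nth_le_marginal[of \<nu> i j] by (auto simp: kern_def)

lemma kern_pos: "(\<And>i j. 0 < \<nu> $ (i, j)) \<Longrightarrow> 0 < kern \<nu> i j"
  using marginal_pos[of \<nu> i] by (simp add: kern_def)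

lemma sum_kern: "(\<Sum>j\<in>UNIV. kern \<nu> i j) = 1"
  by (cases "marginal \<nu> $ i = 0")
    (simp_all add: kern_def sum_divide_distrib[symmetric] marginal_nth[symmetric])

text \<open>The uniform default row does no harm here: if the marginal is 0, the entry is squeezed
  between 0 and it.\<close>

lemma nth_eq_marginal_kern: "\<nu> \<in> distributions \<Longrightarrow> \<nu> $ (i, j) = marginal \<nu> $ i * kern \<nu> i j"
  using nth_le_marginal[of \<nu> i j] distributions_nonneg[of \<nu> "(i,j)"] by (auto simp: kern_def)

section \<open>Words and their empirical doublets\<close>

text \<open>Functions extensional outside \<open>{1..l}\<close>, so that each word is represented
  exactly once and the set is finite.\<close>

definition words :: "nat \<Rightarrow> (nat \<Rightarrow> 'a) set" where
  "words l = {1..l} \<rightarrow>\<^sub>E UNIV"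

lemma finite_words [simp]: "finite (words l :: (nat \<Rightarrow> 'a::finite) set)"
  by (simp add: words_def finite_PiE)

lemma sum_words_Suc:
  fixes f :: "(nat \<Rightarrow> 'a::finite) \<Rightarrow> real"
  shows "(\<Sum>x\<in>words (Suc l). f x) = (\<Sum>x\<in>words l. \<Sum>j\<in>UNIV. f (x(Suc l := j)))"
proof -
  have "words (Suc l) = (\<lambda>(y, g). g(Suc l := y)) ` (UNIV \<times> (words l :: (nat \<Rightarrow> 'a) set))"
    using PiE_insert_eq[of "Suc l" "{1..l}" "\<lambda>_. UNIV :: 'a set"]
    by (simp add: words_def atLeastAtMostSuc_conv)
  moreover have "inj_on (\<lambda>(y, g). g(Suc l := y)) (UNIV \<times> (words l :: (nat \<Rightarrow> 'a) set))"
    unfolding words_def by (rule inj_combinator) simp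
  ultimately have "(\<Sum>x\<in>words (Suc l). f x) = (\<Sum>(j, x)\<in>UNIV \<times> words l. f (x(Suc l := j)))"
    by (simp add: sum.reindex case_prod_unfold)
  also have "\<dots> = (\<Sum>j\<in>UNIV. \<Sum>x\<in>words l. f (x(Suc l := j)))"
    by (rule sum.cartesian_product[symmetric])
  also have "\<dots> = (\<Sum>x\<in>words l. \<Sum>j\<in>UNIV. f (x(Suc l := j)))"
    by (rule sum.swap)
  finally show ?thesis .
qed

text \<open>Summing over the last letter yields a row sum 1, so the induction peels words from their
  end. The initial weight \<open>a\<close> is kept free: constant 1 serves for counting words, the
  marginal for the total probability.\<close>

lemma sum_paths:
  fixes K :: "'a::finite \<Rightarrow> 'a \<Rightarrow> real"
  assumes "\<And>i. (\<Sum>j\<in>UNIV. K i j) = 1"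
  shows "(\<Sum>x\<in>words (Suc l). a (x 1) * (\<Prod>t=1..<Suc l. K (x t) (x (t + 1)))) = (\<Sum>i\<in>UNIV. a i)"
proof (induction l)
  case 0
  show ?case unfolding sum_words_Suc by (simp add: words_def)
next
  case (Suc l)
  have "(\<Sum>x\<in>words (Suc (Suc l)). a (x 1) * (\<Prod>t=1..<Suc (Suc l). K (x t) (x (t + 1))))
    = (\<Sum>x\<in>words (Suc l). \<Sum>j\<in>UNIV. a (x 1) * (\<Prod>t=1..<Suc l. K (x t) (x (t + 1))) * K (x (Suc l)) j)"
    unfolding sum_words_Suc[of _ "Suc l"]
    by (intro sum.cong refl) simp
  also have "\<dots> = (\<Sum>x\<in>words (Suc l). a (x 1) * (\<Prod>t=1..<Suc l. K (x t) (x (t + 1))))"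
    by (simp add: sum_distrib_left[symmetric] assms)
  finally show ?case using Suc by simp
qed

definition cyclic_pair :: "nat \<Rightarrow> (nat \<Rightarrow> 'a) \<Rightarrow> nat \<Rightarrow> 'a \<times> 'a" where
  "cyclic_pair l x t = (x t, if t = l then x 1 else x (t + 1))"

lemma empirical_doublet_nth:
  "empirical_doublet l x $ ij = (\<Sum>t=1..l. indicator {ij} (cyclic_pair l x t)) / real l"
  by (simp add: empirical_doublet_def cyclic_pair_def)

text \<open>Exchanges averages over the doublet distribution with averages over time. Constants,
  indicators and logarithms of transition probabilities are inserted for \<open>f\<close>
  later.\<close>

lemma sum_empirical_doublet:
  assumes "l \<ge> 1"
  shows "real l * (\<Sum>ij\<in>UNIV. empirical_doublet l x $ ij * f ij) = (\<Sum>t=1..l. f (cyclic_pair l x t))"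
proof -
  have "real l * (\<Sum>ij\<in>UNIV. empirical_doublet l x $ ij * f ij)
     = (\<Sum>ij\<in>UNIV. \<Sum>t=1..l. indicator {ij} (cyclic_pair l x t) * f ij)"
    using assms by (simp add: empirical_doublet_nth sum_distrib_left sum_distrib_right sum_divide_distrib)
  also have "\<dots> = (\<Sum>t=1..l. \<Sum>ij\<in>UNIV. indicator {ij} (cyclic_pair l x t) * f ij)"
    by (rule sum.swap)
  also have "\<dots> = (\<Sum>t=1..l. f (cyclic_pair l x t))"
    by (intro sum.cong refl) (simp add: indicator_def if_distrib[of "\<lambda>c. c * _"] cong: if_cong)
  finally show ?thesis .
qed

lemma empirical_doublet_cong:
  "(\<And>t. t \<in> {1..l} \<Longrightarrow> x t = y t) \<Longrightarrow> empirical_doublet l x = empirical_doublet l y"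
  unfolding vec_eq_iff empirical_doublet_nth cyclic_pair_def
  by (intro allI arg_cong[of _ _ "\<lambda>s. s / real l"] sum.cong refl arg_cong2[of _ _ _ _ indicator]) auto

lemma empirical_doublet_pos:
  assumes "t \<in> {1..l}"
  shows "empirical_doublet l x $ cyclic_pair l x t > 0"
proof -
  have "0 < (\<Sum>s=1..l. indicator {cyclic_pair l x t} (cyclic_pair l x s) :: real)"
    by (rule sum_pos2[of _ t]) (use assms in \<open>auto simp: indicator_def\<close>)
  then show ?thesis using assms by (simp add: empirical_doublet_nth)
qed

text \<open>The wrap-around makes the second components of the doublets a cyclic shift of the word;
  this is the reason for stationarity.\<close>

lemma sum_cyclic_shift:
  fixes g :: "'a \<Rightarrow> real" and l :: nat
  assumes "l \<ge> 1"
  shows "(\<Sum>t=1..l. g (if t = l then x 1 else x (t + 1))) = (\<Sum>t=1..l. g (x t))"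
proof -
  obtain k where l: "l = Suc k" using assms by (cases l) auto
  have "(\<Sum>t=1..l. g (if t = l then x 1 else x (t + 1))) = (\<Sum>t=1..k. g (x (Suc t))) + g (x 1)"
    unfolding l by simp
  also have "(\<Sum>t=1..k. g (x (Suc t))) = (\<Sum>t=Suc 1..Suc k. g (x t))"
    by (rule sum.shift_bounds_cl_Suc_ivl[symmetric])
  also have "\<dots> + g (x 1) = (\<Sum>t=1..l. g (x t))"
    unfolding l using sum.atLeast_Suc_atMost[of 1 "Suc k" "\<lambda>t. g (x t)"] by simp
  finally show ?thesis .
qed

lemma empirical_doublet_stationary:
  assumes "l \<ge> 1"
  shows "empirical_doublet l x \<in> stationary_distributions"
proof -
  let ?\<xi> = "empirical_doublet l x"
  have "(\<Sum>ij\<in>UNIV. ?\<xi> $ ij) = 1"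
    using sum_empirical_doublet[OF assms, of x "\<lambda>_. 1"] assms by simp
  moreover have "0 \<le> ?\<xi> $ ij" for ij
    by (simp add: empirical_doublet_nth sum_nonneg)
  moreover have "(\<Sum>j\<in>UNIV. ?\<xi> $ (i, j)) = (\<Sum>j\<in>UNIV. ?\<xi> $ (j, i))" for i
  proof -
    \<comment> \<open>Both marginals count the visits to \<open>i\<close>, once through first and
      once through second components.\<close>
    have 1: "(\<Sum>t=1..l. indicator {i} (x t)) = real l * (\<Sum>j\<in>UNIV. ?\<xi> $ (i, j))"
      using sum_empirical_doublet[OF assms, of x "\<lambda>(a,b). indicator {i} a"]
      unfolding sum_UNIV_prod
      by (simp add: cyclic_pair_def indicator_def sum_distrib_right[symmetric])
    have 2: "(\<Sum>t=1..l. indicator {i} (if t = l then x 1 else x (t + 1))) = real l * (\<Sum>j\<in>UNIV. ?\<xi> $ (j, i))"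
      using sum_empirical_doublet[OF assms, of x "\<lambda>(a,b). indicator {i} b"]
      unfolding sum_UNIV_prod
      by (simp add: cyclic_pair_def indicator_def  cong: if_cong)
    show ?thesis
      using 1 2 sum_cyclic_shift[OF assms, of "indicator {i}" x] assms by simp
  qed
  ultimately show ?thesis by (simp add: stationary_distributions_def distributions_def)
qed

text \<open>Each entry is \<open>k / l\<close> with an integer \<open>k\<close> between 0 and
  \<open>l\<close>, which leaves \<open>l + 1\<close> choices per doublet.\<close>

lemma card_empirical_doublets:
  assumes "l \<ge> 1"
  shows "finite (range (empirical_doublet l :: (nat \<Rightarrow> 'a::finite) \<Rightarrow> _))"
    "card (range (empirical_doublet l :: (nat \<Rightarrow> 'a::finite) \<Rightarrow> _)) \<le> (l + 1) ^ CARD('a \<times> 'a)"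
proof -
  let ?F = "UNIV \<rightarrow>\<^sub>E {0..l} :: ('a \<times> 'a \<Rightarrow> nat) set"
  let ?g = "\<lambda>k. (\<chi> ij. real (k ij) / real l) :: real ^ ('a \<times> 'a)"
  have sub: "range (empirical_doublet l :: (nat \<Rightarrow> 'a) \<Rightarrow> _) \<subseteq> ?g ` ?F"
  proof clarify
    fix x :: "nat \<Rightarrow> 'a"
    let ?k = "\<lambda>ij. card {t \<in> {1..l}. cyclic_pair l x t = ij}"
    have "?k ij \<le> l" for ij
      using card_mono[of "{1..l}" "{t \<in> {1..l}. cyclic_pair l x t = ij}"] by (simp add: subset_eq)
    then have "?k \<in> ?F" by (simp add: PiE_UNIV_domain)
    then have "?g ?k \<in> ?g ` ?F" by (rule imageI)
    moreover have "empirical_doublet l x = ?g ?k"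
      by (simp add: vec_eq_iff empirical_doublet_nth indicator_def sum.If_cases Int_def)
    ultimately show "empirical_doublet l x \<in> ?g ` ?F" by (simp only:)
  qed
  have fin: "finite ?F" by (simp add: finite_PiE)
  show "finite (range (empirical_doublet l :: (nat \<Rightarrow> 'a) \<Rightarrow> _))"
    using sub fin finite_subset by blast
  have "card (range (empirical_doublet l :: (nat \<Rightarrow> 'a) \<Rightarrow> _)) \<le> card (?g ` ?F)"
    using sub fin by (intro card_mono) auto
  also have "\<dots> \<le> card ?F" using fin by (rule card_image_le)
  also have "\<dots> = (l + 1) ^ CARD('a \<times> 'a)" by (simp add: card_PiE)
  finally show "card (range (empirical_doublet l :: (nat \<Rightarrow> 'a) \<Rightarrow> _)) \<le> (l + 1) ^ CARD('a \<times> 'a)" .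
qed

section \<open>Path products and the size of a type class\<close>

text \<open>The log-likelihood per step under \<open>kern \<mu>\<close> of a word of type
  \<open>\<xi>\<close>; it is linear in \<open>\<xi>\<close>. For \<open>\<mu> = \<xi>\<close> it is
  minus the conditional entropy.\<close>

definition log_kern :: "real ^ ('a::finite \<times> 'a) \<Rightarrow> real ^ ('a \<times> 'a) \<Rightarrow> real" where
  "log_kern \<mu> \<xi> = (\<Sum>(i, j)\<in>UNIV. \<xi> $ (i, j) * ln (kern \<mu> i j))"

text \<open>The factor \<open>kern \<mu> (x l) (x 1)\<close> closes the cycle. Positivity is asked
  only along the doublets of the word, so that the type of the word itself can be taken for
  \<open>\<mu>\<close> even if it has zero entries.\<close>

lemma prod_kern_cyclic:
  assumes "l \<ge> 1" and "\<And>t. t \<in> {1..l} \<Longrightarrow> case_prod (kern \<mu>) (cyclic_pair l x t) > 0"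
  shows "(\<Prod>t=1..<l. kern \<mu> (x t) (x (t + 1))) * kern \<mu> (x l) (x 1)
    = exp (real l * log_kern \<mu> (empirical_doublet l x))"
proof -
  have "real l * log_kern \<mu> (empirical_doublet l x)
      = (\<Sum>t=1..l. ln (case_prod (kern \<mu>) (cyclic_pair l x t)))"
    using sum_empirical_doublet[OF assms(1), of x "\<lambda>(i,j). ln (kern \<mu> i j)"]
    by (simp add: log_kern_def case_prod_unfold)
  then have "exp (real l * log_kern \<mu> (empirical_doublet l x))
      = (\<Prod>t=1..l. case_prod (kern \<mu>) (cyclic_pair l x t))"
    using assms(2) by (simp add: exp_sum)
  also have "{1..l} = insert l {1..<l}" using assms(1) by auto
  also have "(\<Prod>t\<in>insert l {1..<l}. case_prod (kern \<mu>) (cyclic_pair l x t))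
     = kern \<mu> (x l) (x 1) * (\<Prod>t=1..<l. case_prod (kern \<mu>) (cyclic_pair l x t))"
    by (simp add: cyclic_pair_def)
  also have "(\<Prod>t=1..<l. case_prod (kern \<mu>) (cyclic_pair l x t)) = (\<Prod>t=1..<l. kern \<mu> (x t) (x (t + 1)))"
    by (intro prod.cong) (auto simp: cyclic_pair_def)
  finally show ?thesis by simp
qed

lemma card_type_class:
  fixes \<xi> :: "real ^ ('a::finite \<times> 'a)"
  assumes l: "l \<ge> 1"
  shows "real (card {x \<in> words l. empirical_doublet l x = \<xi>}) * exp (real l * log_kern \<xi> \<xi>) \<le> real CARD('a)"
proof (cases "{x \<in> words l. empirical_doublet l x = \<xi>} = {}")
  case False
  then have \<xi>: "\<xi> \<in> distributions"
    using empirical_doublet_stationary[OF l] stationary_distributionsD(1) by blast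
  let ?p = "\<lambda>x. (\<Prod>t=1..<l. kern \<xi> (x t) (x (t + 1)))"
  have "real (card {x \<in> words l. empirical_doublet l x = \<xi>}) * exp (real l * log_kern \<xi> \<xi>)
     = (\<Sum>x\<in>{x \<in> words l. empirical_doublet l x = \<xi>}. exp (real l * log_kern \<xi> \<xi>))"
    by simp
  also have "\<dots> \<le> (\<Sum>x\<in>{x \<in> words l. empirical_doublet l x = \<xi>}. ?p x)"
  proof (rule sum_mono)
    fix x assume "x \<in> {x \<in> words l. empirical_doublet l x = \<xi>}"
    then have e: "empirical_doublet l x = \<xi>" by simp
    have "case_prod (kern \<xi>) (cyclic_pair l x t) > 0" if "t \<in> {1..l}" for t
      using empirical_doublet_pos[OF that, of x] \<xi> unfolding e
      by (cases "cyclic_pair l x t") (simp add: kern_pos_of_nth)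
    from prod_kern_cyclic[OF l this] have "exp (real l * log_kern \<xi> \<xi>) = ?p x * kern \<xi> (x l) (x 1)"
      by (simp add: e)
    \<comment> \<open>Dropping the closing transition can only enlarge the product.\<close>
    also have "\<dots> \<le> ?p x * 1"
      by (intro mult_left_mono kern_le_1[OF \<xi>] prod_nonneg) (simp add: kern_nonneg[OF \<xi>])
    finally show "exp (real l * log_kern \<xi> \<xi>) \<le> ?p x" by simp
  qed
  also have "\<dots> \<le> (\<Sum>x\<in>words l. ?p x)"
    by (intro sum_mono2 prod_nonneg) (auto simp: kern_nonneg[OF \<xi>])
  \<comment> \<open>With initial weight 1 in every state, the path products over all words add up to
    the number of states.\<close>
  also have "\<dots> = real CARD('a)"
    using sum_paths[of "kern \<xi>" "\<lambda>_. 1" "l - 1"] l by (simp add: sum_kern)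
  finally show ?thesis .
next
  case True
  then show ?thesis by (simp only: card.empty)
qed

definition path_weight :: "real ^ ('a::finite \<times> 'a) \<Rightarrow> nat \<Rightarrow> (nat \<Rightarrow> 'a) \<Rightarrow> real" where
  "path_weight \<mu> l x = marginal \<mu> $ x 1 * (\<Prod>t=1..<l. kern \<mu> (x t) (x (t + 1)))"

lemma path_weight_nonneg: "\<mu> \<in> distributions \<Longrightarrow> 0 \<le> path_weight \<mu> l x"
  by (simp add: path_weight_def prod_nonneg kern_nonneg marginal_nonneg)

lemma path_weight_bounds:
  fixes \<mu> :: "real ^ ('a::finite \<times> 'a)"
  assumes "\<And>i j. 0 < \<mu> $ (i, j)"
  obtains a b where "0 < a" "0 < b"
    "\<And>l x. l \<ge> 1 \<Longrightarrow> a * exp (real l * log_kern \<mu> (empirical_doublet l x)) \<le> path_weight \<mu> l x"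
    "\<And>l x. l \<ge> 1 \<Longrightarrow> path_weight \<mu> l x \<le> b * exp (real l * log_kern \<mu> (empirical_doublet l x))"
proof -
  \<comment> \<open>The weight of a word carries an initial probability but no closing transition.
    Their quotient depends only on the last and first letters, hence takes finitely many values, all
    positive.\<close>
  define r where "r = (\<lambda>(i, j). marginal \<mu> $ j / kern \<mu> i j)"
  have rpos: "0 < r p" for p
    using marginal_pos[OF assms] kern_pos[OF assms] by (auto simp: r_def split: prod.split)
  have eq: "path_weight \<mu> l x = r (x l, x 1) * exp (real l * log_kern \<mu> (empirical_doublet l x))"
    if "l \<ge> 1" for l x
    using prod_kern_cyclic[OF that, of \<mu> x] kern_pos[OF assms]
    by (simp add: path_weight_def r_def case_prod_unfold field_simps less_imp_neq[symmetric])
  show ?thesis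
  proof
    show "0 < Min (range r)" using rpos by (subst Min_gr_iff) auto
    show "0 < Max (range r)" using rpos by (subst Max_gr_iff) auto
  qed (auto simp: eq intro!: mult_right_mono)
qed

section \<open>Upper bound\<close>

text \<open>The probability, under the chain of \<open>\<mu>\<close>, that the empirical doublet
  lies in \<open>\<Gamma>\<close>. Being a finite sum over words, it can be used for the chain of
  any other \<open>\<nu>\<close> without constructing a process.\<close>

definition type_weight :: "real ^ ('a::finite \<times> 'a) \<Rightarrow> nat \<Rightarrow> (real ^ ('a \<times> 'a)) set \<Rightarrow> real" where
  "type_weight \<mu> l \<Gamma> = (\<Sum>x\<in>{x \<in> words l. empirical_doublet l x \<in> \<Gamma>}. path_weight \<mu> l x)"

lemma cond_div_eq_log_kern:
  assumes "\<xi> \<in> distributions" "\<And>i j. 0 < \<mu> $ (i, j)"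
  shows "cond_div \<xi> \<mu> = log_kern \<xi> \<xi> - log_kern \<mu> \<xi>"
proof -
  have "\<xi> $ (i, j) * ln (kern \<xi> i j / kern \<mu> i j) = \<xi> $ (i, j) * ln (kern \<xi> i j) - \<xi> $ (i, j) * ln (kern \<mu> i j)" for i j
  proof (cases "\<xi> $ (i, j) = 0")
    case False
    then have "0 < \<xi> $ (i, j)" using distributions_nonneg[OF assms(1), of "(i, j)"] by simp
    then show ?thesis
      using kern_pos_of_nth[OF assms(1), of i j] kern_pos[OF assms(2), of i j]
      by (simp add: ln_div right_diff_distrib)
  qed simp
  then show ?thesis
    by (simp add: cond_div_def log_kern_def sum_subtractf case_prod_unfold)
qed

text \<open>\<open>C\<close> is chosen before \<open>l\<close>, \<open>\<Gamma>\<close> and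
  \<open>m\<close>. A real lower bound \<open>m\<close> stands in place of the infimum, so infinite
  values never enter the estimate.\<close>

lemma type_weight_le:
  fixes \<mu> :: "real ^ ('a::finite \<times> 'a)"
  assumes \<mu>: "\<And>i j. 0 < \<mu> $ (i, j)"
  obtains C where "0 < C"
    "\<And>l \<Gamma> m. l \<ge> 1 \<Longrightarrow> (\<And>\<xi>. \<xi> \<in> \<Gamma> \<Longrightarrow> \<xi> \<in> stationary_distributions \<Longrightarrow> m \<le> cond_div \<xi> \<mu>) \<Longrightarrow>
      type_weight \<mu> l \<Gamma> \<le> C * real (l + 1) ^ CARD('a \<times> 'a) * exp (- (real l * m))"
proof -
  obtain b where b: "0 < b"
    "\<And>l x. l \<ge> 1 \<Longrightarrow> path_weight \<mu> l x \<le> b * exp (real l * log_kern \<mu> (empirical_doublet l x))"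
    using path_weight_bounds[OF \<mu>] by metis
  define n where "n = real CARD('a)"
  have n: "0 < n" by (simp add: n_def)
  show ?thesis
  proof
    show "0 < b * n" using b n by simp
    fix l :: nat and \<Gamma> m
    assume l: "l \<ge> 1"
      and m: "\<And>\<xi>. \<xi> \<in> \<Gamma> \<Longrightarrow> \<xi> \<in> stationary_distributions \<Longrightarrow> m \<le> cond_div \<xi> \<mu>"
    define A where "A = {x \<in> words l. empirical_doublet l x \<in> \<Gamma>}"
    have finA: "finite A" by (simp add: A_def)
    \<comment> \<open>Words are grouped by type, since all words of one type obey the same weight
      bound.\<close>
    have "type_weight \<mu> l \<Gamma> = (\<Sum>\<xi>\<in>empirical_doublet l ` A. \<Sum>x\<in>{x \<in> A. empirical_doublet l x = \<xi>}. path_weight \<mu> l x)"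
      unfolding type_weight_def A_def[symmetric] by (rule sum.image_gen[OF finA])
    also have "\<dots> \<le> (\<Sum>\<xi>\<in>empirical_doublet l ` A. b * n * exp (- (real l * m)))"
    proof (rule sum_mono)
      fix \<xi> assume "\<xi> \<in> empirical_doublet l ` A"
      then have \<xi>: "\<xi> \<in> \<Gamma>" "\<xi> \<in> stationary_distributions"
        using empirical_doublet_stationary[OF l] by (auto simp: A_def)
      let ?T = "{x \<in> words l. empirical_doublet l x = \<xi>}"
      have T: "{x \<in> A. empirical_doublet l x = \<xi>} = ?T"
        using \<xi> by (auto simp: A_def)
      have "(\<Sum>x\<in>{x \<in> A. empirical_doublet l x = \<xi>}. path_weight \<mu> l x) \<le> (\<Sum>x\<in>?T. b * exp (real l * log_kern \<mu> \<xi>))"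
        unfolding T by (rule sum_mono) (use b(2)[OF l] in auto)
      \<comment> \<open>The weight exponent \<open>log_kern \<mu> \<xi>\<close> is
        \<open>log_kern \<xi> \<xi> - cond_div \<xi> \<mu>\<close>; its first part cancels against
        the size of the type class.\<close>
      also have "\<dots> = b * (real (card ?T) * exp (real l * log_kern \<xi> \<xi>)) * exp (- (real l * cond_div \<xi> \<mu>))"
        using cond_div_eq_log_kern[OF stationary_distributionsD(1)[OF \<xi>(2)] \<mu>]
        by (simp add: exp_add[symmetric] mult.assoc right_diff_distrib)
      also have "\<dots> \<le> b * n * exp (- (real l * m))"
        using card_type_class[OF l, of \<xi>] m[OF \<xi>] b(1) n
        by (intro mult_mono) (auto simp: n_def intro: mult_left_mono)
      finally show "(\<Sum>x\<in>{x \<in> A. empirical_doublet l x = \<xi>}. path_weight \<mu> l x) \<le> b * n * exp (- (real l * m))" .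
    qed
    also have "\<dots> = b * n * exp (- (real l * m)) * real (card (empirical_doublet l ` A))"
      by simp
    also have "\<dots> \<le> b * n * exp (- (real l * m)) * real (l + 1) ^ CARD('a \<times> 'a)"
    proof (intro mult_left_mono)
      have "card (empirical_doublet l ` A) \<le> card (range (empirical_doublet l :: (nat \<Rightarrow> 'a) \<Rightarrow> _))"
        by (intro card_mono card_empirical_doublets(1)[OF l]) auto
      also have "\<dots> \<le> (l + 1) ^ CARD('a \<times> 'a)" by (rule card_empirical_doublets(2)[OF l])
      finally show "real (card (empirical_doublet l ` A)) \<le> real (l + 1) ^ CARD('a \<times> 'a)"
        by (metis of_nat_le_iff of_nat_power)
    qed (use b(1) n in auto)
    finally show "type_weight \<mu> l \<Gamma> \<le> b * n * real (l + 1) ^ CARD('a \<times> 'a) * exp (- (real l * m))"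
      by (simp add: mult_ac)
  qed
qed

section \<open>Positivity of the conditional divergence and its zeros\<close>

text \<open>This is ln y \<le> y - 1 at y = \<open>q / kern \<xi> i j\<close>, multiplied by the
  entry; equality forces y = 1. Zero entries are checked separately.\<close>

lemma cond_div_term_ge:
  assumes "\<xi> \<in> distributions" "0 < q"
  shows "\<xi> $ (i, j) - marginal \<xi> $ i * q \<le> \<xi> $ (i, j) * ln (kern \<xi> i j / q)"
    and "\<xi> $ (i, j) * ln (kern \<xi> i j / q) = \<xi> $ (i, j) - marginal \<xi> $ i * q \<Longrightarrow>
      \<xi> $ (i, j) = marginal \<xi> $ i * q"
proof -
  let ?x = "\<xi> $ (i, j)" and ?k = "kern \<xi> i j"
  have *: "?x - marginal \<xi> $ i * q \<le> ?x * ln (?k / q) \<and>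
    (?x * ln (?k / q) = ?x - marginal \<xi> $ i * q \<longrightarrow> ?x = marginal \<xi> $ i * q)"
  proof (cases "?x = 0")
    case True
    then show ?thesis using marginal_nonneg[OF assms(1), of i] assms(2) by simp
  next
    case False
    then have x: "0 < ?x" using distributions_nonneg[OF assms(1), of "(i, j)"] by simp
    then have k: "0 < ?k" by (rule kern_pos_of_nth[OF assms(1)])
    have e: "marginal \<xi> $ i * q = ?x * (q / ?k)"
      using nth_eq_marginal_kern[OF assms(1), of i j] k by simp
    have l: "ln (?k / q) = - ln (q / ?k)"
      using k assms(2) by (simp add: ln_div)
    have "?x * ln (q / ?k) \<le> ?x * (q / ?k - 1)"
      using k assms(2) x by (intro mult_left_mono ln_le_minus_one) auto
    moreover have "q / ?k = 1" if "ln (q / ?k) = q / ?k - 1"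
      using ln_eq_minus_one[OF _ that] k assms(2) by simp
    moreover have "ln (q / ?k) = q / ?k - 1" if "?x * - ln (q / ?k) = ?x - ?x * (q / ?k)"
    proof -
      have "?x * (ln (q / ?k) - (q / ?k - 1)) = 0"
        using that unfolding right_diff_distrib by linarith
      then show ?thesis using x by simp
    qed
    ultimately show ?thesis unfolding e l right_diff_distrib by auto
  qed
  from * show "?x - marginal \<xi> $ i * q \<le> ?x * ln (?k / q)" by blast
  from * show "?x * ln (?k / q) = ?x - marginal \<xi> $ i * q \<Longrightarrow> ?x = marginal \<xi> $ i * q" by blast
qed

text \<open>The linear terms \<open>\<xi> $ (i, j) - marginal \<xi> $ i * kern \<mu> i j\<close> sum
  to 0, because rows of \<open>kern \<mu>\<close> sum to 1. Subtracting them turns the divergence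
  into a sum of nonnegative terms \<open>g\<close>, so it vanishes only if each of them
  does.\<close>

lemma
  assumes \<xi>: "\<xi> \<in> distributions" and \<mu>: "\<And>i j. 0 < \<mu> $ (i, j)"
  shows cond_div_nonneg: "0 \<le> cond_div \<xi> \<mu>"
    and cond_div_eq_0D: "cond_div \<xi> \<mu> = 0 \<Longrightarrow> \<xi> $ (i, j) = marginal \<xi> $ i * kern \<mu> i j"
proof -
  define g where "g = (\<lambda>(i, j). \<xi> $ (i, j) * ln (kern \<xi> i j / kern \<mu> i j) - (\<xi> $ (i, j) - marginal \<xi> $ i * kern \<mu> i j))"
  have g: "0 \<le> g p" for p
    using cond_div_term_ge(1)[OF \<xi> kern_pos[OF \<mu>]] by (auto simp: g_def split: prod.split)
  have "(\<Sum>(i, j)\<in>UNIV. \<xi> $ (i, j) - marginal \<xi> $ i * kern \<mu> i j) = 0"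
    by (simp add: sum_UNIV_prod sum_subtractf sum_distrib_left[symmetric] sum_kern marginal_nth)
  then have d: "cond_div \<xi> \<mu> = sum g UNIV"
    by (simp add: cond_div_def g_def case_prod_unfold sum_subtractf)
  show "0 \<le> cond_div \<xi> \<mu>" unfolding d by (simp add: sum_nonneg g)
  assume "cond_div \<xi> \<mu> = 0"
  then have "g (i, j) = 0"
    using sum_nonneg_eq_0_iff[of UNIV g] g unfolding d by simp
  then show "\<xi> $ (i, j) = marginal \<xi> $ i * kern \<mu> i j"
    by (intro cond_div_term_ge(2)[OF \<xi> kern_pos[OF \<mu>]]) (simp add: g_def)
qed

text \<open>The positive matrix \<^term>\<open>kern \<mu>\<close> has only one stationary distribution: for the minimal ratio \<open>r\<close> of the marginals, the nonnegative vector
  \<open>marginal \<xi> - r marginal \<mu>\<close> is stationary and has a zero entry, hence vanishes.\<close>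

lemma cond_div_eq_0_imp_eq:
  fixes \<mu> :: "real ^ ('a::finite \<times> 'a)"
  assumes \<xi>: "\<xi> \<in> stationary_distributions" and \<mu>: "\<mu> \<in> stationary_distributions"
    and pos: "\<And>i j. 0 < \<mu> $ (i, j)" and "cond_div \<xi> \<mu> = 0"
  shows "\<xi> = \<mu>"
proof -
  note \<xi>D = stationary_distributionsD[OF \<xi>] and \<mu>D = stationary_distributionsD[OF \<mu>]
  have *: "\<xi> $ (i, j) = marginal \<xi> $ i * kern \<mu> i j" for i j
    using cond_div_eq_0D[OF \<xi>D(1) pos assms(4)] .
  define r where "r = (\<lambda>i. marginal \<xi> $ i / marginal \<mu> $ i)"
  have "Min (range r) \<in> range r" by (rule Min_in) auto
  then obtain k where k: "r k = Min (range r)" by (metis imageE)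
  define d where "d = (\<lambda>i. marginal \<xi> $ i - r k * marginal \<mu> $ i)"
  have d: "0 \<le> d i" for i
  proof -
    have "r k \<le> r i" by (simp add: k)
    then show ?thesis using marginal_pos[OF pos, of i] by (simp add: d_def r_def field_simps)
  qed
  \<comment> \<open>Column \<open>k\<close> of the stationarity equation for \<open>d\<close>: its
    right side \<open>d k\<close> is 0, so every nonnegative summand is 0, and the positive column
    \<open>kern \<mu> i k\<close> forces \<open>d i = 0\<close>.\<close>
  have "(\<Sum>i\<in>UNIV. d i * kern \<mu> i k) = (\<Sum>i\<in>UNIV. \<xi> $ (i, k) - r k * \<mu> $ (i, k))"
    by (intro sum.cong refl)
      (simp add: d_def left_diff_distrib * nth_eq_marginal_kern[OF \<mu>D(1)])
  also have "\<dots> = d k"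
    by (simp add: sum_subtractf sum_distrib_left[symmetric] \<xi>D \<mu>D d_def)
  also have "d k = 0" using marginal_pos[OF pos, of k] by (simp add: d_def r_def)
  finally have "(\<Sum>i\<in>UNIV. d i * kern \<mu> i k) = 0" .
  then have d_kern: "d i * kern \<mu> i k = 0" for i
    by (subst (asm) sum_nonneg_eq_0_iff) (auto simp: d kern_nonneg[OF \<mu>D(1)])
  then have d0: "marginal \<xi> $ i = r k * marginal \<mu> $ i" for i
    using d_kern[of i] kern_pos[OF pos, of i k] by (simp add: d_def)
  have "r k = 1"
    using \<xi>D(5) \<mu>D(5) by (simp add: d0 sum_distrib_left[symmetric])
  then show ?thesis
    by (simp add: vec_eq_iff * d0 nth_eq_marginal_kern[OF \<mu>D(1)])
qed

section \<open>Lower bound\<close>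

lemma continuous_on_x_ln_x: "continuous_on {0..} (\<lambda>x::real. x * ln x)"
proof -
  \<comment> \<open>With y = 1/x, the limit of x ln x at 0 reduces to ln y / y tending to 0 at
    infinity.\<close>
  have "((\<lambda>x::real. ln (inverse x) / inverse x) \<longlongrightarrow> 0) (at_right 0)"
    by (rule filterlim_compose[OF ln_x_over_x_tendsto_0 filterlim_inverse_at_top_right])
  then have "((\<lambda>x::real. - (ln (inverse x) / inverse x)) \<longlongrightarrow> - 0) (at_right 0)"
    by (rule tendsto_minus)
  moreover have "\<forall>\<^sub>F x::real in at_right 0. - (ln (inverse x) / inverse x) = x * ln x"
    by (auto simp: eventually_at_right_field ln_inverse divide_inverse intro!: exI[of _ 1])
  ultimately have 0: "((\<lambda>x::real. x * ln x) \<longlongrightarrow> 0) (at_right 0)"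
    using Lim_transform_eventually by fastforce
  show ?thesis
    unfolding continuous_on_def
  proof
    fix x :: real assume x: "x \<in> {0..}"
    show "((\<lambda>x. x * ln x) \<longlongrightarrow> x * ln x) (at x within {0..})"
    proof (cases "x = 0")
      case True
      then show ?thesis using 0 by (simp add: at_within_Ici_at_right)
    next
      case False
      then show ?thesis using x by (intro tendsto_intros) auto
    qed
  qed
qed

lemma continuous_on_log_kern: "continuous_on S (log_kern \<mu>)"
  unfolding log_kern_def case_prod_unfold by (intro continuous_intros)

text \<open>\<open>kern \<xi>\<close> may jump where a marginal vanishes, so the divergence is
  rewritten with functions x ln x of entries and marginals, minus the linear
  \<open>log_kern \<mu> \<xi>\<close>.\<close>

lemma continuous_on_cond_div:
  fixes \<mu> :: "real ^ ('a::finite \<times> 'a)"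
  assumes "\<And>i j. 0 < \<mu> $ (i, j)"
  shows "continuous_on distributions (\<lambda>\<xi>. cond_div \<xi> \<mu>)"
proof -
  have "\<xi> $ (i, j) * ln (kern \<xi> i j) = \<xi> $ (i, j) * ln (\<xi> $ (i, j)) - \<xi> $ (i, j) * ln (marginal \<xi> $ i)"
    if "\<xi> \<in> distributions" for \<xi> :: "real ^ ('a \<times> 'a)" and i j
  proof (cases "\<xi> $ (i, j) = 0")
    case False
    then have "0 < \<xi> $ (i, j)" using distributions_nonneg[OF that, of "(i, j)"] by simp
    moreover from this have "0 < marginal \<xi> $ i" using nth_le_marginal[OF that, of i j] by linarith
    ultimately show ?thesis by (simp add: kern_def ln_div right_diff_distrib)
  qed simp
  then have "cond_div \<xi> \<mu> = (\<Sum>ij\<in>UNIV. \<xi> $ ij * ln (\<xi> $ ij))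
      - (\<Sum>i\<in>UNIV. marginal \<xi> $ i * ln (marginal \<xi> $ i)) - log_kern \<mu> \<xi>"
    if "\<xi> \<in> distributions" for \<xi>
    using that
    by (simp add: cond_div_eq_log_kern[OF that assms] log_kern_def[of \<xi>] sum_UNIV_prod sum_subtractf
        sum_distrib_right[symmetric] marginal_nth[symmetric])
  moreover have "continuous_on distributions (\<lambda>\<xi> :: real ^ ('a \<times> 'a). \<xi> $ ij * ln (\<xi> $ ij))" for ij
    by (rule continuous_on_compose2[OF continuous_on_x_ln_x])
      (auto simp: distributions_nonneg intro!: continuous_intros)
  moreover have "continuous_on distributions (\<lambda>\<xi> :: real ^ ('a \<times> 'a). marginal \<xi> $ i * ln (marginal \<xi> $ i))" for i
    by (rule continuous_on_compose2[OF continuous_on_x_ln_x])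
      (auto simp: marginal_nonneg, auto simp: marginal_nth intro!: continuous_intros)
  ultimately show ?thesis
    by (simp add: continuous_on_log_kern continuous_on_diff continuous_on_sum cong: continuous_on_cong)
qed

lemma stationary_subset_distributions: "stationary_distributions \<subseteq> distributions"
  by (auto simp: stationary_distributions_def)

lemma compact_stationary_distributions:
  "compact (stationary_distributions :: (real ^ ('a::finite \<times> 'a)) set)"
proof -
  have "stationary_distributions =
      {\<nu> :: real ^ ('a \<times> 'a). (\<forall>ij. 0 \<le> \<nu> $ ij) \<and> (\<Sum>ij\<in>UNIV. \<nu> $ ij) = 1 \<and>
        (\<forall>i. (\<Sum>j\<in>UNIV. \<nu> $ (i, j)) = (\<Sum>j\<in>UNIV. \<nu> $ (j, i)))}"
    by (auto simp: stationary_distributions_def distributions_def)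
  also have "closed \<dots>"
    by (intro closed_Collect_conj closed_Collect_all closed_Collect_le closed_Collect_eq continuous_intros)
  finally have "closed (stationary_distributions :: (real ^ ('a \<times> 'a)) set)" .
  moreover have "norm \<nu> \<le> 1" if "\<nu> \<in> stationary_distributions" for \<nu> :: "real ^ ('a \<times> 'a)"
    using norm_le_l1_cart[of \<nu>] stationary_distributionsD(2,3)[OF that] by simp
  ultimately show ?thesis
    unfolding compact_eq_bounded_closed bounded_iff by blast
qed

section \<open>Law of large numbers for the chain of a positive distribution\<close>

lemma tendsto_power_mult_exp_minus:
  fixes m :: real
  assumes "0 < m"
  shows "(\<lambda>l. real (l + 1) ^ k * exp (- (real l * m))) \<longlonglongrightarrow> 0"
proof -
  \<comment> \<open>Substituted for y in y^k / exp y, which tends to 0; the factor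
    \<open>exp m / m ^ k\<close> then restores the required sequence.\<close>
  have "filterlim (\<lambda>l. m * real (Suc l)) at_top sequentially"
    using assms by (intro filterlim_tendsto_pos_mult_at_top[OF tendsto_const]
        filterlim_compose[OF filterlim_real_sequentially filterlim_Suc])
  from filterlim_compose[OF tendsto_power_div_exp_0[of k] this]
  have "(\<lambda>l. exp m / m ^ k * ((m * real (Suc l)) ^ k / exp (m * real (Suc l)))) \<longlonglongrightarrow> exp m / m ^ k * 0"
    by (intro tendsto_mult tendsto_const)
  moreover have "exp m / m ^ k * ((m * real (Suc l)) ^ k / exp (m * real (Suc l)))
      = real (l + 1) ^ k * exp (- (real l * m))" for l
  proof -
    have "exp (m * real (Suc l)) = exp m * exp (real l * m)"
      by (simp add: exp_add[symmetric] algebra_simps)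
    moreover have "exp m / m ^ k * ((m * r) ^ k / (exp m * E)) = r ^ k * inverse E" for r E :: real
      using assms by (simp add: power_mult_distrib divide_simps)
    ultimately show ?thesis by (simp only: exp_minus Suc_eq_plus1)
  qed
  ultimately show ?thesis by simp
qed

lemma type_weight_UNIV:
  assumes "\<nu> \<in> stationary_distributions" "l \<ge> 1"
  shows "type_weight \<nu> l UNIV = 1"
  using sum_paths[of "kern \<nu>" "\<lambda>i. marginal \<nu> $ i" "l - 1"] assms
  by (simp add: type_weight_def path_weight_def sum_kern stationary_distributionsD)

lemma type_weight_tendsto_1:
  fixes \<nu> :: "real ^ ('a::finite \<times> 'a)"
  assumes \<nu>: "\<nu> \<in> stationary_distributions" and pos: "\<And>i j. 0 < \<nu> $ (i, j)"
    and op: "openin (top_of_set stationary_distributions) \<Gamma>" and "\<nu> \<in> \<Gamma>"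
  shows "(\<lambda>l. type_weight \<nu> l \<Gamma>) \<longlonglongrightarrow> 1"
proof -
  let ?S = "stationary_distributions :: (real ^ ('a \<times> 'a)) set"
  have comp: "compact (?S - \<Gamma>)"
    using closedin_compact[OF compact_stationary_distributions] closedin_diff[OF closedin_topspace op]
    by (simp only: topspace_euclidean_subtopology)
  \<comment> \<open>The bound is asked only at stationary points of \<open>- \<Gamma>\<close>, the
    only ones that words can produce. If there are none, any positive \<open>m\<close> will
    do.\<close>
  obtain m where m: "0 < m" "\<And>\<xi>. \<xi> \<in> - \<Gamma> \<Longrightarrow> \<xi> \<in> ?S \<Longrightarrow> m \<le> cond_div \<xi> \<nu>"
  proof (cases "?S - \<Gamma> = {}")
    case True
    then show ?thesis using that[of 1] by auto
  next
    case False
    have "continuous_on (?S - \<Gamma>) (\<lambda>\<xi>. cond_div \<xi> \<nu>)"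
      using continuous_on_subset[OF continuous_on_cond_div[OF pos]] stationary_subset_distributions by blast
    then obtain \<zeta> where \<zeta>: "\<zeta> \<in> ?S - \<Gamma>" "\<And>\<xi>. \<xi> \<in> ?S - \<Gamma> \<Longrightarrow> cond_div \<zeta> \<nu> \<le> cond_div \<xi> \<nu>"
      using continuous_attains_inf[OF comp False] by blast
    have "cond_div \<zeta> \<nu> \<noteq> 0" using cond_div_eq_0_imp_eq[OF _ \<nu> pos] \<zeta>(1) \<open>\<nu> \<in> \<Gamma>\<close> by blast
    moreover have "0 \<le> cond_div \<zeta> \<nu>" using cond_div_nonneg[OF _ pos] \<zeta>(1) stationary_subset_distributions by blast
    ultimately show ?thesis using that[of "cond_div \<zeta> \<nu>"] \<zeta>(2) by auto
  qed
  obtain C where C: "0 < C"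
    "\<And>l \<Gamma> m. l \<ge> 1 \<Longrightarrow> (\<And>\<xi>. \<xi> \<in> \<Gamma> \<Longrightarrow> \<xi> \<in> ?S \<Longrightarrow> m \<le> cond_div \<xi> \<nu>) \<Longrightarrow>
      type_weight \<nu> l \<Gamma> \<le> C * real (l + 1) ^ CARD('a \<times> 'a) * exp (- (real l * m))"
    using type_weight_le[OF pos] by metis
  have "(\<lambda>l. 1 - C * (real (l + 1) ^ CARD('a \<times> 'a) * exp (- (real l * m)))) \<longlonglongrightarrow> 1 - C * 0"
    by (intro tendsto_intros tendsto_power_mult_exp_minus m)
  then have lim: "(\<lambda>l. 1 - C * (real (l + 1) ^ CARD('a \<times> 'a) * exp (- (real l * m)))) \<longlonglongrightarrow> 1"
    by simp
  have split: "type_weight \<nu> l \<Gamma> + type_weight \<nu> l (- \<Gamma>) = 1" if "l \<ge> 1" for l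
  proof -
    have "type_weight \<nu> l \<Gamma> + type_weight \<nu> l (- \<Gamma>) = type_weight \<nu> l UNIV"
      unfolding type_weight_def by (subst sum.union_disjoint[symmetric]) (auto intro!: sum.cong)
    then show ?thesis using type_weight_UNIV[OF \<nu> that] by simp
  qed
  have nonneg: "0 \<le> type_weight \<nu> l (- \<Gamma>)" for l
    unfolding type_weight_def
    by (intro sum_nonneg path_weight_nonneg stationary_distributionsD(1)[OF \<nu>])
  show ?thesis
  proof (rule tendsto_sandwich[OF _ _ lim tendsto_const])
    show "\<forall>\<^sub>F l in sequentially. 1 - C * (real (l + 1) ^ CARD('a \<times> 'a) * exp (- (real l * m))) \<le> type_weight \<nu> l \<Gamma>"
      using eventually_ge_at_top[of 1]
    proof eventually_elim
      case (elim l)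
      show ?case using split[OF elim] C(2)[OF elim m(2), of "- \<Gamma>"] by (simp add: mult.assoc)
    qed
    show "\<forall>\<^sub>F l in sequentially. type_weight \<nu> l \<Gamma> \<le> 1"
      using eventually_ge_at_top[of 1]
    proof eventually_elim
      case (elim l)
      show ?case using split[OF elim] nonneg[of l] by linarith
    qed
  qed
qed

section \<open>Change of measure and approximation by positive distributions\<close>

lemma type_weight_ge_pos:
  fixes \<mu> \<nu> :: "real ^ ('a::finite \<times> 'a)"
  assumes \<mu>: "\<And>i j. 0 < \<mu> $ (i, j)" "\<mu> \<in> stationary_distributions"
    and \<nu>: "\<And>i j. 0 < \<nu> $ (i, j)" "\<nu> \<in> stationary_distributions"
    and op: "openin (top_of_set stationary_distributions) \<Gamma>" "\<nu> \<in> \<Gamma>" and D: "cond_div \<nu> \<mu> < D"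
  obtains c where "0 < c" "\<forall>\<^sub>F l in sequentially. c * exp (- (real l * D)) \<le> type_weight \<mu> l \<Gamma>"
proof -
  let ?S = "stationary_distributions :: (real ^ ('a \<times> 'a)) set"
  \<comment> \<open>The difference is the log-likelihood ratio per step between the chains of
    \<open>\<nu>\<close> and \<open>\<mu>\<close>. It is linear in \<open>\<xi>\<close> and equals
    \<open>cond_div \<nu> \<mu>\<close> at \<open>\<nu>\<close>, so the condition is open and holds
    there.\<close>
  define \<Delta> where "\<Delta> = \<Gamma> \<inter> (?S \<inter> (\<lambda>\<xi>. log_kern \<nu> \<xi> - log_kern \<mu> \<xi>) -` {..<D})"
  have "openin (top_of_set ?S) \<Delta>" unfolding \<Delta>_def
    by (intro openin_Int op continuous_openin_preimage_gen continuous_on_diff continuous_on_log_kern) auto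
  moreover have "\<nu> \<in> \<Delta>"
    using op \<nu> D cond_div_eq_log_kern[OF stationary_distributionsD(1)[OF \<nu>(2)] \<mu>(1)] by (simp add: \<Delta>_def)
  ultimately have "(\<lambda>l. type_weight \<nu> l \<Delta>) \<longlonglongrightarrow> 1"
    using type_weight_tendsto_1 \<nu> by blast
  \<comment> \<open>Any constant below 1 would do.\<close>
  then have ev: "\<forall>\<^sub>F l in sequentially. 1 / 2 < type_weight \<nu> l \<Delta>"
    by (rule order_tendstoD) simp
  obtain a where a: "0 < a"
    "\<And>l x. l \<ge> 1 \<Longrightarrow> a * exp (real l * log_kern \<mu> (empirical_doublet l x)) \<le> path_weight \<mu> l x"
    using path_weight_bounds[OF \<mu>(1)] by metis
  obtain b where b: "0 < b"
    "\<And>l x. l \<ge> 1 \<Longrightarrow> path_weight \<nu> l x \<le> b * exp (real l * log_kern \<nu> (empirical_doublet l x))"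
    using path_weight_bounds[OF \<nu>(1)] by metis
  have change: "a / b * exp (- (real l * D)) * path_weight \<nu> l x \<le> path_weight \<mu> l x"
    if l: "l \<ge> 1" and x: "empirical_doublet l x \<in> \<Delta>" for l x
  proof -
    let ?\<xi> = "empirical_doublet l x"
    have "a / b * exp (- (real l * D)) * path_weight \<nu> l x
        \<le> a / b * exp (- (real l * D)) * (b * exp (real l * log_kern \<nu> ?\<xi>))"
      using a(1) b by (intro mult_left_mono b(2)[OF l]) auto
    also have "\<dots> = a * exp (real l * (log_kern \<nu> ?\<xi> - D))"
      using b(1) by (simp add: right_diff_distrib exp_diff exp_minus divide_inverse)
    also have "\<dots> \<le> a * exp (real l * log_kern \<mu> ?\<xi>)"
      using a(1) x l by (simp add: \<Delta>_def)
    also have "\<dots> \<le> path_weight \<mu> l x" by (rule a(2)[OF l])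
    finally show ?thesis .
  qed
  have mono: "a / b * exp (- (real l * D)) * type_weight \<nu> l \<Delta> \<le> type_weight \<mu> l \<Gamma>" if l: "l \<ge> 1" for l
  proof -
    have "a / b * exp (- (real l * D)) * type_weight \<nu> l \<Delta>
       \<le> (\<Sum>x\<in>{x \<in> words l. empirical_doublet l x \<in> \<Delta>}. path_weight \<mu> l x)"
      unfolding type_weight_def sum_distrib_left by (intro sum_mono change[OF l]) auto
    also have "\<dots> \<le> type_weight \<mu> l \<Gamma>"
      unfolding type_weight_def
      by (intro sum_mono2 path_weight_nonneg stationary_distributionsD(1)[OF \<mu>(2)]) (auto simp: \<Delta>_def)
    finally show ?thesis .
  qed
  show ?thesis
  proof
    show "0 < a / b / 2" using a b by simp
    show "\<forall>\<^sub>F l in sequentially. a / b / 2 * exp (- (real l * D)) \<le> type_weight \<mu> l \<Gamma>"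
      using ev eventually_ge_at_top[of 1]
    proof eventually_elim
      case (elim l)
      have "a / b * exp (- (real l * D)) * (1 / 2) \<le> a / b * exp (- (real l * D)) * type_weight \<nu> l \<Delta>"
        using elim(1) a(1) b(1) by (intro mult_left_mono) auto
      with mono[OF elim(2)] show ?case by simp
    qed
  qed
qed

lemma stationary_distributions_convex_comb:
  fixes e :: real
  assumes "\<nu> \<in> stationary_distributions" "\<mu> \<in> stationary_distributions" "0 \<le> e" "e \<le> 1"
  shows "(1 - e) *\<^sub>R \<nu> + e *\<^sub>R \<mu> \<in> stationary_distributions"
  using assms
  by (simp add: stationary_distributions_def distributions_def sum.distrib sum_distrib_left[symmetric])

lemma open_stationary_contains_pos:
  fixes \<mu> \<nu> :: "real ^ ('a::finite \<times> 'a)"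
  assumes \<mu>: "\<And>i j. 0 < \<mu> $ (i, j)" "\<mu> \<in> stationary_distributions"
    and op: "openin (top_of_set stationary_distributions) \<Gamma>" "\<nu> \<in> \<Gamma>"
  obtains \<xi> where "\<xi> \<in> \<Gamma>" "\<And>i j. 0 < \<xi> $ (i, j)"
proof -
  obtain T where T: "open T" "\<Gamma> = stationary_distributions \<inter> T"
    using op(1) by (auto simp: openin_open)
  have \<nu>: "\<nu> \<in> stationary_distributions" "\<nu> \<in> T" using op T by auto
  have "((\<lambda>e::real. (1 - e) *\<^sub>R \<nu> + e *\<^sub>R \<mu>) \<longlongrightarrow> (1 - 0) *\<^sub>R \<nu> + 0 *\<^sub>R \<mu>) (at_right 0)"
    by (intro tendsto_intros)
  then have "\<forall>\<^sub>F e::real in at_right 0. (1 - e) *\<^sub>R \<nu> + e *\<^sub>R \<mu> \<in> T"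
    by (rule topological_tendstoD) (use T \<nu> in auto)
  moreover have "\<forall>\<^sub>F e::real in at_right 0. 0 < e \<and> e < 1"
    by (auto simp: eventually_at_right_field intro!: exI[of _ 1])
  ultimately have "\<exists>e::real. (1 - e) *\<^sub>R \<nu> + e *\<^sub>R \<mu> \<in> T \<and> 0 < e \<and> e < 1"
    by (intro eventually_happens'[OF trivial_limit_at_right_real]) (rule eventually_conj)
  then obtain e :: real where e: "(1 - e) *\<^sub>R \<nu> + e *\<^sub>R \<mu> \<in> T" "0 < e" "e < 1" by blast
  show ?thesis
  proof
    show "(1 - e) *\<^sub>R \<nu> + e *\<^sub>R \<mu> \<in> \<Gamma>"
      using e T stationary_distributions_convex_comb[OF \<nu>(1) \<mu>(2)] by auto
    show "0 < ((1 - e) *\<^sub>R \<nu> + e *\<^sub>R \<mu>) $ (i, j)" for i j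
      using e \<mu>(1) stationary_distributionsD(2)[OF \<nu>(1), of "(i, j)"]
      by (simp add: add_nonneg_pos)
  qed
qed

lemma type_weight_ge:
  fixes \<mu> \<nu> :: "real ^ ('a::finite \<times> 'a)"
  assumes \<mu>: "\<And>i j. 0 < \<mu> $ (i, j)" "\<mu> \<in> stationary_distributions"
    and op: "openin (top_of_set stationary_distributions) \<Gamma>" "\<nu> \<in> \<Gamma>" and D: "cond_div \<nu> \<mu> < D"
  obtains c where "0 < c" "\<forall>\<^sub>F l in sequentially. c * exp (- (real l * D)) \<le> type_weight \<mu> l \<Gamma>"
proof -
  let ?S = "stationary_distributions :: (real ^ ('a \<times> 'a)) set"
  have sub: "\<Gamma> \<subseteq> ?S" using openin_imp_subset[OF op(1)] .
  \<comment> \<open>The divergence must stay below \<open>D\<close> when \<open>\<nu>\<close> is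
    replaced by a positive point, so the open set is first shrunk by continuity.\<close>
  let ?\<Delta> = "\<Gamma> \<inter> (?S \<inter> (\<lambda>\<xi>. cond_div \<xi> \<mu>) -` {..<D})"
  have "openin (top_of_set ?S) ?\<Delta>"
    by (intro openin_Int op continuous_openin_preimage_gen
        continuous_on_subset[OF continuous_on_cond_div[OF \<mu>(1)] stationary_subset_distributions]) auto
  moreover have "\<nu> \<in> ?\<Delta>" using op D sub by auto
  ultimately obtain \<xi> where "\<xi> \<in> ?\<Delta>" "\<And>i j. 0 < \<xi> $ (i, j)"
    using open_stationary_contains_pos[OF \<mu>] by metis
  then show ?thesis
    using type_weight_ge_pos[OF \<mu> _ _ op(1), of \<xi> D] that by auto
qed

section \<open>The large deviation property\<close>

lemma rel_entropy_eq_ereal: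
  assumes "\<And>i. 0 < \<mu> $ i"
  shows "rel_entropy \<nu> \<mu> = ereal (\<Sum>i\<in>UNIV. \<nu> $ i * ln (\<nu> $ i / \<mu> $ i))"
  unfolding rel_entropy_def sum_ereal[symmetric]
  by (intro sum.cong refl) (use assms in \<open>auto simp: less_imp_neq[symmetric]\<close>)

text \<open>The quotient of the doublet ratio by the marginal ratio is the ratio of transition
  probabilities. Positivity of \<open>\<mu>\<close> makes both relative entropies finite, so their
  difference is a real subtraction.\<close>

lemma cond_rel_entropy_eq_cond_div:
  fixes \<mu> :: "real ^ ('a::finite \<times> 'a)"
  assumes "\<nu> \<in> distributions" "\<And>i j. 0 < \<mu> $ (i, j)"
  shows "cond_rel_entropy \<nu> \<mu> = ereal (cond_div \<nu> \<mu>)"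
proof -
  have "\<nu> $ (i, j) * ln (\<nu> $ (i, j) / \<mu> $ (i, j)) - \<nu> $ (i, j) * ln (marginal \<nu> $ i / marginal \<mu> $ i)
      = \<nu> $ (i, j) * ln (kern \<nu> i j / kern \<mu> i j)" for i j
  proof (cases "\<nu> $ (i, j) = 0")
    case False
    then have n: "0 < \<nu> $ (i, j)" using distributions_nonneg[OF assms(1), of "(i, j)"] by simp
    then have "0 < marginal \<nu> $ i" using nth_le_marginal[OF assms(1), of i j] by linarith
    then show ?thesis
      using n assms(2)[of i j] marginal_pos[of \<mu> i, OF assms(2)]
      by (simp add: kern_def ln_div ln_mult algebra_simps)
  qed simp
  then have "cond_div \<nu> \<mu> = (\<Sum>ij\<in>UNIV. \<nu> $ ij * ln (\<nu> $ ij / \<mu> $ ij))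
      - (\<Sum>i\<in>UNIV. marginal \<nu> $ i * ln (marginal \<nu> $ i / marginal \<mu> $ i))"
    by (simp add: cond_div_def sum_UNIV_prod marginal_nth[of \<nu>] sum_distrib_right sum_subtractf[symmetric])
  moreover have "0 < \<mu> $ ij" for ij using assms(2) by (cases ij) simp
  ultimately show ?thesis
    unfolding cond_rel_entropy_def
    by (simp add: rel_entropy_eq_ereal marginal_pos assms(2))
qed

section \<open>The law of the words and of their empirical doublets\<close>

lemma markov_chain_sets:
  assumes "markov_chain M X" "t \<ge> 1"
  shows "{\<omega> \<in> space M. X t \<omega> = i} \<in> sets M"
proof -
  have "X t -` {i} \<inter> space M \<in> sets M"
    using assms by (intro measurable_sets[of _ _ "count_space UNIV"]) (auto simp: markov_chain_def)
  then show ?thesis by (simp add: vimage_def Int_def conj_commute)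
qed

lemma prob_words:
  fixes X :: "nat \<Rightarrow> 'w \<Rightarrow> 'a::finite" and \<mu> :: "real ^ ('a \<times> 'a)"
  assumes "prob_space M" and chain: "markov_chain M X"
    and \<mu>: "\<And>t i j. t \<ge> 1 \<Longrightarrow> \<mu> $ (i, j) = \<P>(\<omega> in M. X t \<omega> = i \<and> X (t + 1) \<omega> = j)"
    and pos: "\<And>i j. 0 < \<mu> $ (i, j)" and "l \<ge> 1"
  shows "\<P>(\<omega> in M. \<forall>s\<in>{1..l}. X s \<omega> = x s) = path_weight \<mu> l x"
proof -
  interpret prob_space M by fact
  have marg: "\<P>(\<omega> in M. X t \<omega> = i) = marginal \<mu> $ i" if t: "t \<ge> 1" for t i
  proof -
    let ?A = "\<lambda>j. {\<omega> \<in> space M. X t \<omega> = i \<and> X (t + 1) \<omega> = j}"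
    have "\<P>(\<omega> in M. X t \<omega> = i) = measure M (\<Union>j\<in>UNIV. ?A j)"
      by (rule arg_cong[of _ _ "measure M"]) auto
    also have "\<dots> = (\<Sum>j\<in>UNIV. measure M (?A j))"
      by (rule finite_measure_finite_Union)
        (use markov_chain_sets[OF chain] t in \<open>auto simp: disjoint_family_on_def intro!: sets.sets_Collect_conj\<close>)
    also have "\<dots> = marginal \<mu> $ i" using \<mu>[OF t] by (simp add: marginal_nth)
    finally show ?thesis .
  qed
  show ?thesis
    using \<open>l \<ge> 1\<close>
  proof (induction l rule: nat_induct_at_least)
    case base
    show ?case using marg[of 1 "x 1"] by (simp add: path_weight_def)
  next
    case (Suc l)
    let ?Q = "\<lambda>\<omega>. \<forall>s\<in>{1..l}. X s \<omega> = x s"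
    \<comment> \<open>The Markov property speaks only about pasts of positive probability; the
      induction hypothesis provides this as a product of positive factors.\<close>
    have Q: "\<P>(\<omega> in M. ?Q \<omega>) > 0"
      unfolding Suc.IH path_weight_def
      by (intro mult_pos_pos prod_pos marginal_pos kern_pos pos ballI)
    have "\<P>(\<omega> in M. X (l + 1) \<omega> = x (l + 1) \<bar> ?Q \<omega>) = \<P>(\<omega> in M. X (l + 1) \<omega> = x (l + 1) \<bar> X l \<omega> = x l)"
      using chain Q Suc.hyps unfolding markov_chain_def by blast
    also have "\<dots> = kern \<mu> (x l) (x (l + 1))"
      using \<mu>[OF Suc.hyps, of "x l" "x (l + 1)"] marg[OF Suc.hyps, of "x l"] marginal_pos[OF pos, of "x l"]
      by (simp add: cond_prob_def kern_def conj_commute)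
    finally have "\<P>(\<omega> in M. X (l + 1) \<omega> = x (l + 1) \<and> ?Q \<omega>) = kern \<mu> (x l) (x (l + 1)) * path_weight \<mu> l x"
      using Q unfolding cond_prob_def Suc.IH by (simp add: field_simps)
    moreover have "(\<forall>s\<in>{1..Suc l}. X s \<omega> = x s) \<longleftrightarrow> X (l + 1) \<omega> = x (l + 1) \<and> ?Q \<omega>" for \<omega>
      by (simp add: atLeastAtMostSuc_conv)
    ultimately show ?case
      using Suc.hyps by (simp add: path_weight_def prod.atLeastLessThan_Suc mult_ac)
  qed
qed

text \<open>The event is the disjoint union of the cylinders of the finitely many words whose type
  lies in \<open>\<Gamma>\<close>.\<close>

lemma prob_empirical_doublet:
  fixes X :: "nat \<Rightarrow> 'w \<Rightarrow> 'a::finite" and \<mu> :: "real ^ ('a \<times> 'a)"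
  assumes "prob_space M" and chain: "markov_chain M X"
    and \<mu>: "\<And>t i j. t \<ge> 1 \<Longrightarrow> \<mu> $ (i, j) = \<P>(\<omega> in M. X t \<omega> = i \<and> X (t + 1) \<omega> = j)"
    and pos: "\<And>i j. 0 < \<mu> $ (i, j)" and l: "l \<ge> 1"
  shows "\<P>(\<omega> in M. empirical_doublet l (\<lambda>t. X t \<omega>) \<in> \<Gamma>) = type_weight \<mu> l \<Gamma>"
proof -
  interpret prob_space M by fact
  let ?A = "{x \<in> words l. empirical_doublet l x \<in> \<Gamma>}"
  let ?E = "\<lambda>x. {\<omega> \<in> space M. \<forall>s\<in>{1..l}. X s \<omega> = x s}"
  have "{\<omega> \<in> space M. empirical_doublet l (\<lambda>t. X t \<omega>) \<in> \<Gamma>} = (\<Union>x\<in>?A. ?E x)"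
  proof (intro equalityI subsetI)
    fix \<omega> assume \<omega>: "\<omega> \<in> {\<omega> \<in> space M. empirical_doublet l (\<lambda>t. X t \<omega>) \<in> \<Gamma>}"
    let ?x = "restrict (\<lambda>t. X t \<omega>) {1..l}"
    have "empirical_doublet l ?x = empirical_doublet l (\<lambda>t. X t \<omega>)"
      by (rule empirical_doublet_cong) simp
    then have "?x \<in> ?A" using \<omega> by (simp add: words_def)
    then show "\<omega> \<in> (\<Union>x\<in>?A. ?E x)" using \<omega> by (intro UN_I) auto
  next
    fix \<omega> assume "\<omega> \<in> (\<Union>x\<in>?A. ?E x)"
    then obtain x where x: "x \<in> ?A" "\<omega> \<in> ?E x" by blast
    then have "empirical_doublet l (\<lambda>t. X t \<omega>) = empirical_doublet l x"
      by (intro empirical_doublet_cong) auto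
    then show "\<omega> \<in> {\<omega> \<in> space M. empirical_doublet l (\<lambda>t. X t \<omega>) \<in> \<Gamma>}" using x by simp
  qed
  then have "\<P>(\<omega> in M. empirical_doublet l (\<lambda>t. X t \<omega>) \<in> \<Gamma>) = measure M (\<Union>x\<in>?A. ?E x)"
    by simp
  also have "\<dots> = (\<Sum>x\<in>?A. measure M (?E x))"
  proof (rule finite_measure_finite_Union)
    show "?E ` ?A \<subseteq> sets M"
      using markov_chain_sets[OF chain] by (auto intro!: sets.sets_Collect_finite_All)
    show "disjoint_family_on ?E ?A"
      unfolding disjoint_family_on_def
    proof (intro ballI impI)
      fix x y assume "x \<in> ?A" "y \<in> ?A" "x \<noteq> y"
      then obtain s where "s \<in> {1..l}" "x s \<noteq> y s"
        unfolding words_def by (metis (mono_tags, lifting) PiE_ext mem_Collect_eq)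
      then show "?E x \<inter> ?E y = {}" by force
    qed
  qed simp
  also have "\<dots> = type_weight \<mu> l \<Gamma>"
    unfolding type_weight_def by (intro sum.cong refl prob_words[OF assms(1-2)] \<mu> pos l)
  finally show ?thesis .
qed

section \<open>From exponential bounds to logarithmic limits\<close>

lemma limsup_elog_le:
  assumes "0 < C" "\<And>l. l \<ge> 1 \<Longrightarrow> 0 \<le> p l" "\<And>l. l \<ge> 1 \<Longrightarrow> p l \<le> C * real (l + 1) ^ k * exp (- (real l * m))"
  shows "limsup (\<lambda>l. ereal (1 / real l) * elog (p l)) \<le> ereal (- m)"
proof -
  \<comment> \<open>The logarithm of the assumed bound divided by \<open>l\<close>; the constant and
    the polynomial factor disappear in the limit.\<close>
  let ?u = "\<lambda>l. ln C / real l + real k * (ln (real (Suc l)) / real l) - m"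
  have u: "ereal (1 / real l) * elog (p l) \<le> ereal (?u l)" if l: "l \<ge> 1" for l
  proof (cases "p l = 0")
    \<comment> \<open>Here \<open>elog\<close> is minus infinity and stays so, because
      \<open>1 / real l\<close> is positive.\<close>
    case True
    then show ?thesis using l by (simp add: elog_def)
  next
    case False
    then have p: "0 < p l" using assms(2)[OF l] by simp
    then have "ln (p l) \<le> ln (C * real (l + 1) ^ k * exp (- (real l * m)))"
      using assms(3)[OF l] by simp
    also have "\<dots> = ln C + real k * ln (real (Suc l)) - real l * m"
      using assms(1) by (simp add: ln_mult ln_realpow add.commute)
    finally show ?thesis using l p by (simp add: elog_def field_simps)
  qed
  have "(\<lambda>l. ln (real (Suc l)) / real l) \<longlonglongrightarrow> 0"
  proof (rule Lim_null_comparison)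
    show "(\<lambda>l. ln 2 / real l + ln (real l) / real l) \<longlonglongrightarrow> 0"
      using tendsto_add[OF lim_const_over_n[of "ln 2"] lim_ln_over_n] by simp
    show "\<forall>\<^sub>F l in sequentially. norm (ln (real (Suc l)) / real l) \<le> ln 2 / real l + ln (real l) / real l"
      using eventually_ge_at_top[of 1]
    proof eventually_elim
      case (elim l)
      have "ln (real (Suc l)) \<le> ln (2 * real l)" using elim by (subst ln_le_cancel_iff) auto
      also have "\<dots> = ln 2 + ln (real l)" using elim by (simp add: ln_mult)
      finally show ?case using elim by (simp add: add_divide_distrib[symmetric] divide_right_mono)
    qed
  qed
  then have "?u \<longlonglongrightarrow> 0 + real k * 0 - m"
    by (intro tendsto_intros lim_const_over_n)
  then have "(\<lambda>l. ereal (?u l)) \<longlonglongrightarrow> ereal (- m)" by simp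
  then have "limsup (\<lambda>l. ereal (?u l)) = ereal (- m)"
    by (intro lim_imp_Limsup) auto
  moreover have "limsup (\<lambda>l. ereal (1 / real l) * elog (p l)) \<le> limsup (\<lambda>l. ereal (?u l))"
    by (intro Limsup_mono eventually_mono[OF eventually_ge_at_top[of 1]] u)
  ultimately show ?thesis by simp
qed

lemma liminf_elog_ge:
  assumes "0 < c" "\<forall>\<^sub>F l in sequentially. c * exp (- (real l * D)) \<le> p l"
  shows "ereal (- D) \<le> liminf (\<lambda>l. ereal (1 / real l) * elog (p l))"
proof -
  let ?u = "\<lambda>l. ln c / real l - D"
  have "\<forall>\<^sub>F l in sequentially. ereal (?u l) \<le> ereal (1 / real l) * elog (p l)"
    using assms(2) eventually_ge_at_top[of 1]
  proof eventually_elim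
    case (elim l)
    have c: "0 < c * exp (- (real l * D))" using assms(1) by simp
    \<comment> \<open>The lower bound makes \<open>p l\<close> positive, so
      \<open>elog (p l)\<close> is a genuine logarithm.\<close>
    then have "ln (c * exp (- (real l * D))) \<le> ln (p l)" and p: "0 < p l"
      using elim(1) by (auto simp del: ln_mult)
    then have "ln c - real l * D \<le> ln (p l)" using assms(1) by (simp add: ln_mult)
    then have "(ln c - real l * D) / real l \<le> ln (p l) / real l" by (rule divide_right_mono) simp
    then show ?case using p elim(2) by (simp add: elog_def diff_divide_distrib)
  qed
  then have "liminf (\<lambda>l. ereal (?u l)) \<le> liminf (\<lambda>l. ereal (1 / real l) * elog (p l))"
    by (rule Liminf_mono)
  moreover have "?u \<longlonglongrightarrow> 0 - D"
    by (intro tendsto_intros lim_const_over_n)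
  then have "(\<lambda>l. ereal (?u l)) \<longlonglongrightarrow> ereal (- D)" by simp
  then have "liminf (\<lambda>l. ereal (?u l)) = ereal (- D)"
    by (intro lim_imp_Liminf) auto
  ultimately show ?thesis by simp
qed

theorem theorem7:
  fixes M :: "'w measure"
    and X :: "nat \<Rightarrow> 'w \<Rightarrow> 'a::finite"
    and \<mu> :: "real ^ ('a \<times> 'a)"
  assumes "prob_space M"
    and "markov_chain M X"
    and "stationary_process M X"
    and "\<mu> \<in> stationary_distributions"
    and "\<And>t i j. t \<ge> 1 \<Longrightarrow> \<mu> $ (i, j) = \<P>(\<omega> in M. X t \<omega> = i \<and> X (t + 1) \<omega> = j)"
    and "\<And>i j. \<mu> $ (i, j) > 0"
  shows "large_deviation_property M (top_of_set stationary_distributions)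
    (\<lambda>l \<omega>. empirical_doublet l (\<lambda>t. X t \<omega>)) (\<lambda>\<nu>. cond_rel_entropy \<nu> \<mu>)"
proof -
  let ?S = "stationary_distributions :: (real ^ ('a \<times> 'a)) set"
  let ?p = "\<lambda>\<Gamma> l. \<P>(\<omega> in M. empirical_doublet l (\<lambda>t. X t \<omega>) \<in> \<Gamma>)"
  have p: "?p \<Gamma> l = type_weight \<mu> l \<Gamma>" if "l \<ge> 1" for l \<Gamma>
    using prob_empirical_doublet[OF assms(1,2,5,6) that] .
  have I: "cond_rel_entropy \<nu> \<mu> = ereal (cond_div \<nu> \<mu>)" if "\<nu> \<in> ?S" for \<nu>
    by (rule cond_rel_entropy_eq_cond_div[OF stationary_distributionsD(1)[OF that] assms(6)])
  have lower: "- (INF \<nu>\<in>\<Gamma>. cond_rel_entropy \<nu> \<mu>) \<le> liminf (\<lambda>l. ereal (1 / real l) * elog (?p \<Gamma> l))"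
    if op: "openin (top_of_set ?S) \<Gamma>" for \<Gamma>
  proof -
    have "- liminf (\<lambda>l. ereal (1 / real l) * elog (?p \<Gamma> l)) \<le> cond_rel_entropy \<nu> \<mu>" if \<nu>: "\<nu> \<in> \<Gamma>" for \<nu>
    proof -
      have "\<nu> \<in> ?S" using \<nu> openin_imp_subset[OF op] by blast
      \<comment> \<open>The lower estimate needs an exponent strictly above the divergence, hence
        the slack \<open>e\<close>, which is removed afterwards by letting it be arbitrarily
        small.\<close>
      moreover have "- liminf (\<lambda>l. ereal (1 / real l) * elog (?p \<Gamma> l)) \<le> ereal (cond_div \<nu> \<mu>) + ereal e"
        if e: "0 < e" for e
      proof -
        obtain c where c: "0 < c"
          "\<forall>\<^sub>F l in sequentially. c * exp (- (real l * (cond_div \<nu> \<mu> + e))) \<le> type_weight \<mu> l \<Gamma>"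
          using type_weight_ge[OF assms(6,4) op \<nu>, of "cond_div \<nu> \<mu> + e"] e by auto
        have "\<forall>\<^sub>F l in sequentially. c * exp (- (real l * (cond_div \<nu> \<mu> + e))) \<le> ?p \<Gamma> l"
          using c(2) eventually_ge_at_top[of 1] by eventually_elim (simp add: p)
        from liminf_elog_ge[OF c(1) this]
        have "- liminf (\<lambda>l. ereal (1 / real l) * elog (?p \<Gamma> l)) \<le> - ereal (- (cond_div \<nu> \<mu> + e))"
          by (simp only: ereal_minus_le_minus)
        then show ?thesis by (simp add: add.commute)
      qed
      ultimately show ?thesis by (simp only: I) (rule ereal_le_epsilon2, blast)
    qed
    then have "- liminf (\<lambda>l. ereal (1 / real l) * elog (?p \<Gamma> l)) \<le> (INF \<nu>\<in>\<Gamma>. cond_rel_entropy \<nu> \<mu>)"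
      by (rule INF_greatest)
    then show ?thesis by (subst ereal_uminus_le_reorder)
  qed
  obtain C where C: "0 < C"
    "\<And>l \<Gamma> m. l \<ge> 1 \<Longrightarrow> (\<And>\<xi>. \<xi> \<in> \<Gamma> \<Longrightarrow> \<xi> \<in> ?S \<Longrightarrow> m \<le> cond_div \<xi> \<mu>) \<Longrightarrow>
      type_weight \<mu> l \<Gamma> \<le> C * real (l + 1) ^ CARD('a \<times> 'a) * exp (- (real l * m))"
    using type_weight_le[OF assms(6)] by metis
  have upper: "limsup (\<lambda>l. ereal (1 / real l) * elog (?p \<Gamma> l)) \<le> - (INF \<nu>\<in>\<Gamma>. cond_rel_entropy \<nu> \<mu>)" for \<Gamma>
  proof -
    have "(INF \<nu>\<in>\<Gamma>. cond_rel_entropy \<nu> \<mu>) \<le> - limsup (\<lambda>l. ereal (1 / real l) * elog (?p \<Gamma> l))"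
    proof (rule ccontr)
      assume "\<not> (INF \<nu>\<in>\<Gamma>. cond_rel_entropy \<nu> \<mu>) \<le> - limsup (\<lambda>l. ereal (1 / real l) * elog (?p \<Gamma> l))"
      \<comment> \<open>A real number strictly between the two sides serves as the lower bound of
        the divergence on \<open>\<Gamma>\<close>, and covers an infinite infimum, as for empty
        \<open>\<Gamma>\<close>, without a case distinction.\<close>
      then obtain m where m: "- limsup (\<lambda>l. ereal (1 / real l) * elog (?p \<Gamma> l)) < ereal m"
        "ereal m < (INF \<nu>\<in>\<Gamma>. cond_rel_entropy \<nu> \<mu>)"
        unfolding not_le by (blast dest: ereal_dense2)
      have "m \<le> cond_div \<xi> \<mu>" if "\<xi> \<in> \<Gamma>" "\<xi> \<in> ?S" for \<xi>
        using less_INF_D[OF m(2) that(1)] I[OF that(2)] by simp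
      then have "limsup (\<lambda>l. ereal (1 / real l) * elog (?p \<Gamma> l)) \<le> ereal (- m)"
        using C(2) by (intro limsup_elog_le[OF C(1), where k = "CARD('a \<times> 'a)"])
          (simp, simp only: p)
      then have "- ereal (- m) \<le> - limsup (\<lambda>l. ereal (1 / real l) * elog (?p \<Gamma> l))"
        by (simp only: ereal_minus_le_minus)
      then show False using m(1) by simp
    qed
    then have "- (- limsup (\<lambda>l. ereal (1 / real l) * elog (?p \<Gamma> l))) \<le> - (INF \<nu>\<in>\<Gamma>. cond_rel_entropy \<nu> \<mu>)"
      by (simp only: ereal_minus_le_minus)
    then show ?thesis by simp
  qed
  show ?thesis
    unfolding large_deviation_property_def topspace_euclidean_subtopology
  proof (intro conjI allI impI ballI)
    show "empirical_doublet l (\<lambda>t. X t \<omega>) \<in> ?S" if "l \<ge> 1" for l \<omega>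
      using empirical_doublet_stationary[OF that] .
    show "cond_rel_entropy \<nu> \<mu> \<noteq> - \<infinity>" if "\<nu> \<in> ?S" for \<nu>
      by (simp add: I[OF that])
  qed (use lower upper in auto)
qed

end
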